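(* For all integers $r>s\ge 2$ with $r\ge 4$, we have $G^{\mathrm{Pink}}_{r,s,\infty}=B_{r,s,\infty}$.
   Context: $T_\infty$ is the infinite binary rooted tree whose nodes are finite words in $\{a,b\}$ (root = empty word, $w$ joined to $wa,wb$), with automorphism group $\mathrm{Aut}(T_\infty)$ (length- and prefix-preserving permutations of words), given its profinite topology. For $\sigma\in\mathrm{Aut}(T_\infty)$ and a word $x$, $\mathrm{Par}(\sigma,x)\in\mathbb{Z}/2\mathbb{Z}$ is $0$ if $\sigma(xa)=\sigma(x)a$ and $1$ if $\sigma(xa)=\sigma(x)b$; an automorphism is determined by its parities at all nodes. For $r>s\ge1$ define $P^a_{r,s}(\sigma,x)=\sum_{w\in\{a,b\}^{r-1}}\mathrm{Par}(\sigma,xaw)+\sum_{w'\in\{a,b\}^{s-1}}\mathrm{Par}(\sigma,xbw')$ and $P^b_{r,s}(\sigma,x)=\sum_{w\in\{a,b\}^{r-1}}\mathrm{Par}(\sigma,xbw)+\sum_{w'\in\{a,b\}^{s-1}}\mathrm{Par}(\sigma,xaw')$ in $\mathbb{Z}/2\mathbb{Z}$; $M_{r,s,\infty}$ is the set of $\sigma$ such that all the values $P^a_{r,s}(\sigma,x),P^b_{r,s}(\sigma,x)$ over all nodes $x$ coincide (common value $P_{r,s}(\sigma)$), and $B_{r,s,\infty}=\{\sigma\in M_{r,s,\infty}:P_{r,s}(\sigma)=0\}$. Pink's group: let $\tau\in\mathrm{Aut}(T_\infty)$ have $\mathrm{Par}(\tau,x)=1$ iff $x$ is the root. For $\alpha,\beta\in\mathrm{Aut}(T_\infty)$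 let $(\alpha,\beta)$ be the automorphism with $\mathrm{Par}((\alpha,\beta),\text{root})=0$, $\mathrm{Par}((\alpha,\beta),aw)=\mathrm{Par}(\alpha,w)$, $\mathrm{Par}((\alpha,\beta),bw)=\mathrm{Par}(\beta,w)$. Define $\alpha_1,\dots,\alpha_r$ by $\alpha_1=\tau$, $\alpha_{s+1}=(\alpha_s,\alpha_r)$, $\alpha_i=(\alpha_{i-1},1)$ for $i\ne1,s+1$; explicitly, for $1\le i\le s$, $\mathrm{Par}(\alpha_i,y)=1$ iff $y=a^{i-1}$, and for $s<i\le r$, $\mathrm{Par}(\alpha_i,w)=1$ iff $w=a^{i-s-1}(ba^{r-s-1})^na^s$ for some $n\ge0$ (here $u^j$ is $j$ consecutive copies of the word $u$). $G^{\mathrm{Pink}}_{r,s,\infty}$ is the closure in $\mathrm{Aut}(T_\infty)$ of the subgroup generated by $\alpha_1,\dots,\alpha_r$. *)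

theory Defs
  imports
    "HOL-Analysis.Abstract_Topology"
    "HOL-Algebra.Generated_Groups"
    "HOL-Library.Sublist"
    "HOL-Library.Z2"
begin

text \<open>
  Nodes are words; the children of \<open>w\<close> are \<open>w @ [La]\<close> and \<open>w @ [Lb]\<close>.  The two-element field
  is the type \<^typ>\<open>bit\<close>.
\<close>

datatype letter = La | Lb

type_synonym word = "letter list"

definition tree_aut :: "(word \<Rightarrow> word) set" where
  "tree_aut = {\<sigma>. bij \<sigma> \<and> (\<forall>x. length (\<sigma> x) = length x) \<and>
                  (\<forall>x y. prefix x y \<longrightarrow> prefix (\<sigma> x) (\<sigma> y))}"

definition AutT :: "(word \<Rightarrow> word) monoid" where
  "AutT = \<lparr>carrier = tree_aut, mult = (\<circ>), one = id\<rparr>"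

text \<open>
  The group is the inverse limit of the finite groups \<open>Aut(T\<^sub>n)\<close>, where \<open>T\<^sub>n\<close> consists of the words of
  length at most \<open>n\<close>.  The generating open sets below are the preimages of the points of the
  discrete spaces \<open>Aut(T\<^sub>n)\<close>.
\<close>

definition level_cylinder :: "nat \<Rightarrow> (word \<Rightarrow> word) \<Rightarrow> (word \<Rightarrow> word) set" where
  "level_cylinder n \<rho> = {\<sigma> \<in> tree_aut. \<forall>x. length x \<le> n \<longrightarrow> \<sigma> x = \<rho> x}"

definition profinite_topology :: "(word \<Rightarrow> word) topology" where
  "profinite_topology = topology_generated_by {level_cylinder n \<rho> |n \<rho>. \<rho> \<in> tree_aut}"

definition Par :: "(word \<Rightarrow> word) \<Rightarrow> word \<Rightarrow> bit" where
  "Par \<sigma> x = (if \<sigma> (x @ [La]) = \<sigma> x @ [La] then 0 else 1)"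

definition P\<^sub>a :: "nat \<Rightarrow> nat \<Rightarrow> (word \<Rightarrow> word) \<Rightarrow> word \<Rightarrow> bit" where
  "P\<^sub>a r s \<sigma> x = (\<Sum>w | length w = r - 1. Par \<sigma> (x @ [La] @ w))
             + (\<Sum>w' | length w' = s - 1. Par \<sigma> (x @ [Lb] @ w'))"

definition P\<^sub>b :: "nat \<Rightarrow> nat \<Rightarrow> (word \<Rightarrow> word) \<Rightarrow> word \<Rightarrow> bit" where
  "P\<^sub>b r s \<sigma> x = (\<Sum>w | length w = r - 1. Par \<sigma> (x @ [Lb] @ w))
             + (\<Sum>w' | length w' = s - 1. Par \<sigma> (x @ [La] @ w'))"

definition M_group :: "nat \<Rightarrow> nat \<Rightarrow> (word \<Rightarrow> word) set" where
  "M_group r s = {\<sigma> \<in> tree_aut. \<exists>c. \<forall>x. P\<^sub>a r s \<sigma> x = c \<and> P\<^sub>b r s \<sigma> x = c}"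

definition P_common :: "nat \<Rightarrow> nat \<Rightarrow> (word \<Rightarrow> word) \<Rightarrow> bit" where
  "P_common r s \<sigma> = (THE c. \<forall>x. P\<^sub>a r s \<sigma> x = c \<and> P\<^sub>b r s \<sigma> x = c)"

definition B_group :: "nat \<Rightarrow> nat \<Rightarrow> (word \<Rightarrow> word) set" where
  "B_group r s = {\<sigma> \<in> M_group r s. P_common r s \<sigma> = 0}"

text \<open>Unique existence is \<open>ex1_aut_with_Par\<close> below.\<close>

definition aut_with_Par :: "(word \<Rightarrow> bit) \<Rightarrow> (word \<Rightarrow> word)" where
  "aut_with_Par p = (THE \<sigma>. \<sigma> \<in> tree_aut \<and> (\<forall>x. Par \<sigma> x = p x))"

definition tau :: "word \<Rightarrow> word" where
  "tau = aut_with_Par (\<lambda>x. of_bool (x = []))"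

definition aut_pair :: "(word \<Rightarrow> word) \<Rightarrow> (word \<Rightarrow> word) \<Rightarrow> (word \<Rightarrow> word)" where
  "aut_pair \<alpha> \<beta> = aut_with_Par
     (\<lambda>x. case x of [] \<Rightarrow> 0 | La # w \<Rightarrow> Par \<alpha> w | Lb # w \<Rightarrow> Par \<beta> w)"

text \<open>
  The generator \<open>\<alpha>\<^sub>i\<close>, given by its parities.  The lemmas \<open>pink_gen_1\<close>, \<open>pink_gen_Suc_s\<close> and
  \<open>pink_gen_other\<close> below are the recursion \<open>\<alpha>\<^sub>1 = \<tau>\<close>, \<open>\<alpha>\<^bsub>s+1\<^esub> = (\<alpha>\<^sub>s, \<alpha>\<^sub>r)\<close>, \<open>\<alpha>\<^sub>i = (\<alpha>\<^bsub>i-1\<^esub>, 1)\<close>.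
\<close>

definition pink_gen :: "nat \<Rightarrow> nat \<Rightarrow> nat \<Rightarrow> (word \<Rightarrow> word)" where
  "pink_gen r s i = aut_with_Par (\<lambda>y.
     if i \<le> s then of_bool (y = replicate (i - 1) La)
     else of_bool (\<exists>n. y = replicate (i - s - 1) La
                          @ concat (replicate n (Lb # replicate (r - s - 1) La))
                          @ replicate s La))"

definition G_pink :: "nat \<Rightarrow> nat \<Rightarrow> (word \<Rightarrow> word) set" where
  "G_pink r s = profinite_topology closure_of (generate AutT (pink_gen r s ` {1..r}))"


subsection \<open>Well-definedness\<close>

lemma finite_level: "finite {w :: word. length w = n}"
proof -
  have "(UNIV :: letter set) = {La, Lb}" by (auto intro: letter.exhaust)
  then have "finite (UNIV :: letter set)" by (metis finite.emptyI finite.insertI)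
  from finite_lists_length_eq[OF this, of n] show ?thesis by simp
qed

lemma P_common_eq:
  assumes "\<forall>x. P\<^sub>a r s \<sigma> x = c \<and> P\<^sub>b r s \<sigma> x = c"
  shows "P_common r s \<sigma> = c"
  unfolding P_common_def using assms by (intro the_equality) auto

lemma tree_autD:
  assumes "\<sigma> \<in> tree_aut"
  shows "bij \<sigma>" "length (\<sigma> x) = length x" "prefix x y \<Longrightarrow> prefix (\<sigma> x) (\<sigma> y)"
  using assms by (auto simp: tree_aut_def)

lemma tree_aut_snoc:
  assumes "\<sigma> \<in> tree_aut"
  obtains d where "\<sigma> (x @ [c]) = \<sigma> x @ [d]"
proof -
  have "prefix (\<sigma> x) (\<sigma> (x @ [c]))"
    using tree_autD(3)[OF assms] by simp
  then obtain v where v: "\<sigma> (x @ [c]) = \<sigma> x @ v"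
    by (auto simp: prefix_def)
  have "length (\<sigma> (x @ [c])) = Suc (length (\<sigma> x))"
    using tree_autD(2)[OF assms] by simp
  with v have "length v = Suc 0" by simp
  then obtain d where "v = [d]" by (auto simp: length_Suc_conv)
  with v that show thesis by blast
qed

lemma letter_neq: "c \<noteq> d \<Longrightarrow> c \<noteq> e \<Longrightarrow> d = (e :: letter)"
  by (metis (full_types) letter.exhaust)

lemma tree_aut_eqI:
  assumes "\<sigma> \<in> tree_aut" "\<rho> \<in> tree_aut" and par: "\<And>x. Par \<sigma> x = Par \<rho> x"
  shows "\<sigma> = \<rho>"
proof
  fix x show "\<sigma> x = \<rho> x"
  proof (induction x rule: rev_induct)
    case Nil
    show ?case using tree_autD(2)[OF assms(1), of "[]"] tree_autD(2)[OF assms(2), of "[]"] by simp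
  next
    case (snoc c x)
    obtain d1 where d1: "\<sigma> (x @ [La]) = \<sigma> x @ [d1]" using tree_aut_snoc[OF assms(1)] .
    obtain e1 where e1: "\<rho> (x @ [La]) = \<rho> x @ [e1]" using tree_aut_snoc[OF assms(2)] .
    obtain d2 where d2: "\<sigma> (x @ [Lb]) = \<sigma> x @ [d2]" using tree_aut_snoc[OF assms(1)] .
    obtain e2 where e2: "\<rho> (x @ [Lb]) = \<rho> x @ [e2]" using tree_aut_snoc[OF assms(2)] .
    have "\<sigma> (x @ [La]) \<noteq> \<sigma> (x @ [Lb])"
      using bij_is_inj[OF tree_autD(1)[OF assms(1)]] by (auto dest: injD)
    then have dd: "d1 \<noteq> d2" using d1 d2 by auto
    have "\<rho> (x @ [La]) \<noteq> \<rho> (x @ [Lb])"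
      using bij_is_inj[OF tree_autD(1)[OF assms(2)]] by (auto dest: injD)
    then have ee: "e1 \<noteq> e2" using e1 e2 by auto
    have "(d1 = La) = (e1 = La)"
      using par[of x] d1 e1 by (simp add: Par_def split: if_splits)
    then have de: "d1 = e1" by (cases d1; cases e1) auto
    with dd ee have "d2 = e2" using letter_neq by metis
    with de d1 d2 e1 e2 snoc show ?case by (cases c) auto
  qed
qed

fun flip :: "bit \<Rightarrow> letter \<Rightarrow> letter" where
  "flip e c = (if e = 0 then c else if c = La then Lb else La)"

primrec act :: "word \<Rightarrow> (word \<Rightarrow> bit) \<Rightarrow> word" where
  "act [] p = []"
| "act (c # w) p = flip (p []) c # act w (\<lambda>v. p (c # v))"

lemma length_act [simp]: "length (act x p) = length x"
  by (induction x arbitrary: p) auto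

lemma flip_inj: "flip e c = flip e d \<Longrightarrow> c = d"
  by (cases c; cases d) (auto split: if_splits)

lemma act_inj: "act x p = act y p \<Longrightarrow> x = y"
proof (induction x arbitrary: p y)
  case Nil
  then have "length (act y p) = 0" by simp
  then show ?case by simp
next
  case (Cons c x)
  have "length (act y p) = Suc (length x)" using Cons.prems by (metis length_Cons length_act)
  then obtain d z where "y = d # z" by (auto simp: length_Suc_conv)
  with Cons show ?case using flip_inj[of "p []" c d] by (auto simp del: flip.simps)
qed

lemma act_surj: "\<exists>x. act x p = y"
proof (induction y arbitrary: p)
  case Nil
  have "act [] p = []" by simp
  then show ?case by blast
next
  case (Cons d y)
  define c where "c = flip (p []) d"
  obtain x where "act x (\<lambda>v. p (c # v)) = y" using Cons.IH by blast
  moreover have "flip (p []) c = d" unfolding c_def by (cases d) auto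
  ultimately have "act (c # x) p = d # y" by simp
  then show ?case by blast
qed

lemma act_append: "act (x @ y) p = act x p @ act y (\<lambda>v. p (x @ v))"
  by (induction x arbitrary: p) auto

lemma act_in_tree_aut: "(\<lambda>x. act x p) \<in> tree_aut"
proof -
  have "bij (\<lambda>x. act x p)"
    using act_inj act_surj[of p] by (auto simp: bij_def inj_def surj_def) metis
  moreover have "prefix x y \<Longrightarrow> prefix (act x p) (act y p)" for x y
    by (auto simp: act_append prefix_def)
  ultimately show ?thesis by (simp add: tree_aut_def)
qed

lemma Par_act: "Par (\<lambda>x. act x p) x = p x"
  by (cases "p x") (auto simp: Par_def act_append)

lemma ex1_aut_with_Par: "\<exists>!\<sigma>. \<sigma> \<in> tree_aut \<and> (\<forall>x. Par \<sigma> x = p x)"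
proof (rule ex1I[of _ "\<lambda>x. act x p"])
  show "(\<lambda>x. act x p) \<in> tree_aut \<and> (\<forall>x. Par (\<lambda>x. act x p) x = p x)"
    using act_in_tree_aut Par_act by blast
next
  fix \<sigma> assume "\<sigma> \<in> tree_aut \<and> (\<forall>x. Par \<sigma> x = p x)"
  then show "\<sigma> = (\<lambda>x. act x p)"
    by (intro tree_aut_eqI) (auto simp: act_in_tree_aut Par_act)
qed

lemma aut_with_Par_in_tree_aut: "aut_with_Par p \<in> tree_aut"
  and Par_aut_with_Par [simp]: "Par (aut_with_Par p) x = p x"
  using theI'[OF ex1_aut_with_Par[of p]] unfolding aut_with_Par_def by auto

lemma Par_id [simp]: "Par id x = 0"
  by (simp add: Par_def)

lemma tree_aut_inv_into:
  assumes "\<sigma> \<in> tree_aut"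
  shows "inv_into UNIV \<sigma> \<in> tree_aut"
proof -
  have b: "bij \<sigma>" using tree_autD(1)[OF assms] .
  have si: "\<sigma> (inv_into UNIV \<sigma> x) = x" for x using b by (simp add: bij_is_surj surj_f_inv_f)
  have inj: "\<sigma> x = \<sigma> y \<Longrightarrow> x = y" for x y using b by (metis bij_is_inj injD)
  have len: "length (inv_into UNIV \<sigma> x) = length x" for x
    using tree_autD(2)[OF assms, of "inv_into UNIV \<sigma> x"] si by simp
  have "prefix (inv_into UNIV \<sigma> x) (inv_into UNIV \<sigma> y)" if "prefix x y" for x y
  proof -
    define u where "u = take (length x) (inv_into UNIV \<sigma> y)"
    have pu: "prefix u (inv_into UNIV \<sigma> y)" unfolding u_def by (rule take_is_prefix)
    then have "prefix (\<sigma> u) y" using tree_autD(3)[OF assms] si by metis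
    moreover have "length u = length x"
      using prefix_length_le[OF that] by (simp add: u_def len)
    then have "length (\<sigma> u) = length x" using tree_autD(2)[OF assms] by simp
    ultimately have "\<sigma> u = x" using that by (auto simp: prefix_def)
    then have "u = inv_into UNIV \<sigma> x" using inj si by metis
    then show ?thesis using pu by simp
  qed
  then show ?thesis using len b by (auto simp: tree_aut_def bij_imp_bij_inv)
qed

lemma group_AutT: "group AutT"
proof (rule groupI)
  fix x y assume "x \<in> carrier AutT" "y \<in> carrier AutT"
  then show "x \<otimes>\<^bsub>AutT\<^esub> y \<in> carrier AutT"
    by (auto simp: AutT_def tree_aut_def intro: bij_comp)
next
  fix x assume x: "x \<in> carrier AutT"
  have "(inv_into UNIV x) \<circ> x = id"
    using x by (simp add: AutT_def tree_aut_def bij_is_inj)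
  then show "\<exists>y\<in>carrier AutT. y \<otimes>\<^bsub>AutT\<^esub> x = \<one>\<^bsub>AutT\<^esub>"
    using x tree_aut_inv_into[of x] by (auto simp: AutT_def)
qed (auto simp: AutT_def tree_aut_def comp_assoc)

lemma pink_gen_1:
  assumes "1 \<le> s"
  shows "pink_gen r s 1 = tau"
  using assms by (simp add: pink_gen_def tau_def)

lemma pink_gen_Suc_s:
  assumes "1 \<le> s" "s < r"
  shows "pink_gen r s (s + 1) = aut_pair (pink_gen r s s) (pink_gen r s r)"
proof -
  let ?u = "Lb # replicate (r - s - 1) La"
  have *: "(\<exists>n. y = concat (replicate n ?u) @ replicate s La) \<longleftrightarrow>
     (case y of [] \<Rightarrow> False | La # w \<Rightarrow> w = replicate (s - 1) La
       | Lb # w \<Rightarrow> (\<exists>n. w = replicate (r - s - 1) La @ concat (replicate n ?u) @ replicate s La))"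
    (is "?L \<longleftrightarrow> ?R") for y
  proof -
    obtain t where t: "s = Suc t" using assms by (cases s) auto
    have "?L \<longleftrightarrow> y = replicate s La \<or> (\<exists>n. y = concat (replicate (Suc n) ?u) @ replicate s La)"
    proof
      assume ?L
      then obtain n where n: "y = concat (replicate n ?u) @ replicate s La" by blast
      show "y = replicate s La \<or> (\<exists>n. y = concat (replicate (Suc n) ?u) @ replicate s La)"
        using n by (cases n) auto
    next
      assume "y = replicate s La \<or> (\<exists>n. y = concat (replicate (Suc n) ?u) @ replicate s La)"
      moreover have "y = concat (replicate 0 ?u) @ replicate s La" if "y = replicate s La"
        using that by simp
      ultimately show ?L by blast
    qed
    also have "\<dots> \<longleftrightarrow> ?R"
      by (auto simp: t split: list.splits letter.splits)
    finally show ?thesis .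
  qed
  have "(\<lambda>y. of_bool (\<exists>n. y = concat (replicate n ?u) @ replicate s La) :: bit) =
     (\<lambda>x. case x of [] \<Rightarrow> 0 | La # w \<Rightarrow> Par (pink_gen r s s) w | Lb # w \<Rightarrow> Par (pink_gen r s r) w)"
    unfolding * using assms
    by (intro ext) (auto simp: pink_gen_def split: list.splits letter.splits)
  then show ?thesis
    unfolding aut_pair_def by (subst (1) pink_gen_def) simp
qed

lemma pink_gen_other:
  assumes "1 \<le> s" "s < r" "i \<in> {1..r}" "i \<noteq> 1" "i \<noteq> s + 1"
  shows "pink_gen r s i = aut_pair (pink_gen r s (i - 1)) id"
proof -
  let ?u = "Lb # replicate (r - s - 1) La"
  have "(if i \<le> s then of_bool (y = replicate (i - 1) La)
     else of_bool (\<exists>n. y = replicate (i - s - 1) La @ concat (replicate n ?u) @ replicate s La) :: bit)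
    = (case y of [] \<Rightarrow> 0 | La # w \<Rightarrow> Par (pink_gen r s (i - 1)) w | Lb # w \<Rightarrow> Par id w)" for y
  proof (cases "i \<le> s")
    case True
    obtain j where "i = Suc (Suc j)" using assms by (cases i; cases "i - 1") auto
    with True show ?thesis
      by (auto simp: pink_gen_def split: list.splits letter.splits)
  next
    case False
    then obtain j where j: "i = s + Suc (Suc j)"
      using assms(5) by (intro that[of "i - s - 2"]) simp
    then show ?thesis
      by (auto simp: pink_gen_def split: list.splits letter.splits)
  qed
  then show ?thesis
    unfolding aut_pair_def by (subst (1) pink_gen_def) presburger
qed

end

theory Submission
  imports Defs
begin

text \<open>
  Write \<open>sgn\<^sub>k\<close> for the sum of the parities on level \<open>k\<close>, a homomorphism on the automorphism group.
  A pair \<open>(g, h)\<close> lies in \<open>B\<close> iff \<open>g, h \<in> B\<close>, \<open>sgn\<^bsub>r-1\<^esub> g = sgn\<^bsub>s-1\<^esub> h\<close> and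
  \<open>sgn\<^bsub>s-1\<^esub> g = sgn\<^bsub>r-1\<^esub> h\<close>; since the generators are in \<open>B\<close> and \<open>B\<close> is a closed subgroup,
  \<open>G \<subseteq> B\<close>.  For density let \<open>G\<^sub>0\<close> be the abstract subgroup generated by the \<open>\<alpha>\<^sub>i\<close>.  It contains
  \<open>(\<alpha>\<^sub>i, 1)\<close> for \<open>i \<noteq> s, r\<close>, and \<open>(\<alpha>\<^sub>s, \<alpha>\<^sub>r)\<close>, \<open>(\<alpha>\<^sub>r, \<alpha>\<^sub>s)\<close>.  Some \<open>x\<close> among \<open>\<alpha>\<^sub>1, \<alpha>\<^sub>2\<close> has
  \<open>(x, 1) \<in> G\<^sub>0\<close> and conjugates \<open>\<alpha>\<^sub>s\<close> to an element commuting with \<open>\<alpha>\<^sub>r\<close> (this uses \<open>s \<ge> 2\<close> and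
  \<open>r \<ge> 4\<close>), whence \<open>(1, [\<alpha>\<^sub>r, \<alpha>\<^sub>s]) \<in> G\<^sub>0\<close>.  Thus for \<open>g, h \<in> G\<^sub>0\<close> the two sign conditions
  already imply \<open>(g, h) \<in> G\<^sub>0\<close>, and every element of \<open>B\<close> is approximated by elements of \<open>G\<^sub>0\<close> by
  induction on the level.
\<close>

section \<open>Pairs and the root swap\<close>

text \<open>A recursive form of \<open>aut_pair\<close> (see \<open>aut_pair_eq\<close>): products
  are computed on words instead of through parities.\<close>

fun pair_aut :: "(word \<Rightarrow> word) \<Rightarrow> (word \<Rightarrow> word) \<Rightarrow> word \<Rightarrow> word" where
  "pair_aut g h [] = []"
| "pair_aut g h (La # w) = La # g w"
| "pair_aut g h (Lb # w) = Lb # h w"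

lemma pair_aut_comp: "pair_aut g h \<circ> pair_aut g' h' = pair_aut (g \<circ> g') (h \<circ> h')"
proof
  fix w show "(pair_aut g h \<circ> pair_aut g' h') w = pair_aut (g \<circ> g') (h \<circ> h') w"
    by (cases "(g', h', w)" rule: pair_aut.cases) auto
qed

lemma pair_aut_id: "pair_aut id id = id"
proof
  fix w show "pair_aut id id w = id w"
    by (cases "(id :: word \<Rightarrow> word, id :: word \<Rightarrow> word, w)" rule: pair_aut.cases) auto
qed

lemma aut_with_Par_eq_act: "aut_with_Par p = (\<lambda>x. act x p)"
  by (rule tree_aut_eqI) (auto simp: aut_with_Par_in_tree_aut act_in_tree_aut Par_act)

lemma act_Par:
  assumes "\<sigma> \<in> tree_aut"
  shows "act x (Par \<sigma>) = \<sigma> x"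
proof -
  have "(\<lambda>x. act x (Par \<sigma>)) = \<sigma>"
    by (rule tree_aut_eqI) (auto simp: assms act_in_tree_aut Par_act)
  then show ?thesis by metis
qed

lemma act_zero: "act x (\<lambda>_. 0) = x"
  by (induction x) auto

lemma aut_pair_eq:
  assumes "g \<in> tree_aut" "h \<in> tree_aut"
  shows "aut_pair g h = pair_aut g h"
proof
  fix w show "aut_pair g h w = pair_aut g h w"
    by (cases "(g, h, w)" rule: pair_aut.cases)
       (simp_all add: aut_pair_def aut_with_Par_eq_act act_Par assms)
qed

lemma tau_simps [simp]: "tau [] = []" "tau (La # w) = Lb # w" "tau (Lb # w) = La # w"
  by (auto simp: tau_def aut_with_Par_eq_act act_zero)

lemma tau_tau: "tau \<circ> tau = id"
proof
  fix w show "(tau \<circ> tau) w = id w"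
    by (cases "(id :: word \<Rightarrow> word, id :: word \<Rightarrow> word, w)" rule: pair_aut.cases) auto
qed

lemma tau_pair_tau: "tau \<circ> (pair_aut g h \<circ> tau) = pair_aut h g"
proof
  fix w show "(tau \<circ> (pair_aut g h \<circ> tau)) w = pair_aut h g w"
    by (cases "(g, h, w)" rule: pair_aut.cases) auto
qed

lemma tau_in_tree_aut: "tau \<in> tree_aut"
  unfolding tau_def by (rule aut_with_Par_in_tree_aut)

lemma pair_aut_in_tree_aut:
  assumes "g \<in> tree_aut" "h \<in> tree_aut"
  shows "pair_aut g h \<in> tree_aut"
  using aut_with_Par_in_tree_aut aut_pair_eq[OF assms] by (metis aut_pair_def)

lemma id_in_tree_aut: "id \<in> tree_aut"
  by (auto simp: tree_aut_def)

lemma comp_in_tree_aut: "g \<in> tree_aut \<Longrightarrow> h \<in> tree_aut \<Longrightarrow> g \<circ> h \<in> tree_aut"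
  by (auto simp: tree_aut_def intro: bij_comp)

lemma tree_aut_Nil [simp]: "\<sigma> \<in> tree_aut \<Longrightarrow> \<sigma> [] = []"
  using tree_autD(2)[of \<sigma> "[]"] by simp

lemma Par_pair_aut [simp]:
  "g \<in> tree_aut \<Longrightarrow> Par (pair_aut g h) [] = 0"
  "Par (pair_aut g h) (La # w) = Par g w"
  "Par (pair_aut g h) (Lb # w) = Par h w"
  by (auto simp: Par_def)

lemma Par_tau: "Par tau x = of_bool (x = [])"
  by (simp add: tau_def)

section \<open>Parity sums below a node\<close>

text \<open>For a tree automorphism \<open>g\<close> and \<open>y = []\<close> this is the sign,
  written additively, of the permutation that \<open>g\<close> induces on the words of length
  \<open>k + 1\<close>.\<close>

definition par_sum :: "nat \<Rightarrow> (word \<Rightarrow> word) \<Rightarrow> word \<Rightarrow> bit" where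
  "par_sum k g y = (\<Sum>w | length w = k. Par g (y @ w))"

lemma par_sum_0: "par_sum 0 g y = Par g y"
  by (simp add: par_sum_def)

lemma par_sum_Suc: "par_sum (Suc k) g y = par_sum k g (y @ [La]) + par_sum k g (y @ [Lb])"
proof -
  have eq: "{w :: word. length w = Suc k} = (#) La ` {w. length w = k} \<union> (#) Lb ` {w. length w = k}"
  proof (intro Set.set_eqI iffI)
    fix w :: word assume "w \<in> {w. length w = Suc k}"
    then obtain c v where "w = c # v" "length v = k" by (auto simp: length_Suc_conv)
    then show "w \<in> (#) La ` {w. length w = k} \<union> (#) Lb ` {w. length w = k}"
      by (cases c) auto
  qed auto
  show ?thesis
    unfolding par_sum_def eq
    by (subst sum.union_disjoint) (auto simp: finite_level sum.reindex)
qed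

lemma P\<^sub>a_par_sum: "P\<^sub>a r s g x = par_sum (r - 1) g (x @ [La]) + par_sum (s - 1) g (x @ [Lb])"
  and P\<^sub>b_par_sum: "P\<^sub>b r s g x = par_sum (r - 1) g (x @ [Lb]) + par_sum (s - 1) g (x @ [La])"
  by (simp_all add: P\<^sub>a_def P\<^sub>b_def par_sum_def)

lemma tree_aut_children:
  assumes "h \<in> tree_aut"
  shows "h (y @ [La]) = h y @ [if Par h y = 0 then La else Lb]"
    and "h (y @ [Lb]) = h y @ [if Par h y = 0 then Lb else La]"
proof -
  obtain d where d: "h (y @ [La]) = h y @ [d]" using tree_aut_snoc[OF assms] .
  obtain e where e: "h (y @ [Lb]) = h y @ [e]" using tree_aut_snoc[OF assms] .
  have "h (y @ [La]) \<noteq> h (y @ [Lb])"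
    using bij_is_inj[OF tree_autD(1)[OF assms]] by (auto dest: injD)
  with d e have "d \<noteq> e" by auto
  then show "h (y @ [La]) = h y @ [if Par h y = 0 then La else Lb]"
    and "h (y @ [Lb]) = h y @ [if Par h y = 0 then Lb else La]"
    using d e by (cases d; cases e; auto simp: Par_def)+
qed

lemma Par_comp:
  assumes "g \<in> tree_aut" "h \<in> tree_aut"
  shows "Par (g \<circ> h) x = Par g (h x) + Par h x"
proof (cases "Par h x = 0")
  case True
  then have "(g \<circ> h) (x @ [La]) = g (h x @ [La])"
    using tree_aut_children(1)[OF assms(2), of x] by simp
  with True show ?thesis by (simp add: Par_def)
next
  case False
  then have "(g \<circ> h) (x @ [La]) = g (h x) @ [if Par g (h x) = 0 then Lb else La]"
    using tree_aut_children(1)[OF assms(2), of x] tree_aut_children(2)[OF assms(1), of "h x"] by simp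
  then have "Par (g \<circ> h) x = (if Par g (h x) = 0 then 1 else 0)"
    by (simp add: Par_def[of "g \<circ> h"])
  with False show ?thesis by simp
qed

text \<open>\<open>h\<close> carries the two children of \<open>y\<close> to those of
  \<open>h y\<close> in some order, and the sum does not see the order. At the root this makes every
  level sign a homomorphism.\<close>

lemma par_sum_comp:
  assumes "g \<in> tree_aut" "h \<in> tree_aut"
  shows "par_sum k (g \<circ> h) y = par_sum k g (h y) + par_sum k h y"
proof (induction k arbitrary: y)
  case 0
  show ?case by (simp only: par_sum_0 Par_comp[OF assms])
next
  case (Suc k)
  show ?case
    by (cases "Par h y = 0")
       (simp_all only: par_sum_Suc Suc tree_aut_children[OF assms(2)] if_True if_False simp_thms add_ac)
qed

lemma par_sum_pair_aut [simp]:
  "par_sum k (pair_aut g h) (La # w) = par_sum k g w"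
  "par_sum k (pair_aut g h) (Lb # w) = par_sum k h w"
  by (auto simp: par_sum_def)

lemma par_sum_id [simp]: "par_sum k id y = 0"
  by (simp add: par_sum_def)

lemma par_sum_tau: "y \<noteq> [] \<Longrightarrow> par_sum k tau y = 0"
  by (simp add: par_sum_def Par_tau)

lemma par_sum_tau_root: "par_sum k tau [] = of_bool (k = 0)"
  by (cases k) (simp_all add: par_sum_0 par_sum_Suc par_sum_tau Par_tau)

text \<open>The bound is strict because the parity at a node of length \<open>length y + k\<close>
  reads the maps one level further down.\<close>

lemma par_sum_cong_level:
  assumes "\<And>x. length x \<le> n \<Longrightarrow> g x = h x" and "length y + k < n"
  shows "par_sum k g y = par_sum k h y"
  unfolding par_sum_def Par_def using assms by (intro sum.cong) auto

section \<open>The group B\<close>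

lemma B_group_iff:
  "\<sigma> \<in> B_group r s \<longleftrightarrow> \<sigma> \<in> tree_aut \<and> (\<forall>x. P\<^sub>a r s \<sigma> x = 0 \<and> P\<^sub>b r s \<sigma> x = 0)"
  using P_common_eq[of r s \<sigma>] unfolding B_group_def M_group_def by auto

lemma B_group_tree_aut: "\<sigma> \<in> B_group r s \<Longrightarrow> \<sigma> \<in> tree_aut"
  by (simp add: B_group_iff)

lemma id_in_B_group: "id \<in> B_group r s"
  by (simp add: B_group_iff id_in_tree_aut P\<^sub>a_par_sum P\<^sub>b_par_sum)

lemma tau_in_B_group: "tau \<in> B_group r s"
  by (simp add: B_group_iff tau_in_tree_aut P\<^sub>a_par_sum P\<^sub>b_par_sum par_sum_tau)

text \<open>If \<open>h\<close> swaps the children of \<open>x\<close>, the two sums of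
  \<open>g\<close> at \<open>h x\<close> trade places. The vanishing of both is therefore stable
  under composition.\<close>

lemma P\<^sub>a_comp:
  assumes "g \<in> tree_aut" "h \<in> tree_aut"
  shows "P\<^sub>a r s (g \<circ> h) x = (if Par h x = 0 then P\<^sub>a r s g (h x) else P\<^sub>b r s g (h x)) + P\<^sub>a r s h x"
    and "P\<^sub>b r s (g \<circ> h) x = (if Par h x = 0 then P\<^sub>b r s g (h x) else P\<^sub>a r s g (h x)) + P\<^sub>b r s h x"
  by (cases "Par h x = 0"; simp only: P\<^sub>a_par_sum P\<^sub>b_par_sum par_sum_comp[OF assms]
      tree_aut_children[OF assms(2)] if_True if_False simp_thms add_ac)+

lemma comp_in_B_group:
  assumes "g \<in> B_group r s" "h \<in> B_group r s"
  shows "g \<circ> h \<in> B_group r s"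
  using assms by (simp add: B_group_iff P\<^sub>a_comp comp_in_tree_aut)

lemma P\<^sub>a_pair_aut:
  "P\<^sub>a r s (pair_aut g h) (La # x) = P\<^sub>a r s g x" "P\<^sub>b r s (pair_aut g h) (La # x) = P\<^sub>b r s g x"
  "P\<^sub>a r s (pair_aut g h) (Lb # x) = P\<^sub>a r s h x" "P\<^sub>b r s (pair_aut g h) (Lb # x) = P\<^sub>b r s h x"
  "P\<^sub>a r s (pair_aut g h) [] = par_sum (r - 1) g [] + par_sum (s - 1) h []"
  "P\<^sub>b r s (pair_aut g h) [] = par_sum (r - 1) h [] + par_sum (s - 1) g []"
  by (simp_all add: P\<^sub>a_par_sum P\<^sub>b_par_sum)

lemma bit_add_eq_0: "a + b = 0 \<longleftrightarrow> a = (b :: bit)"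
  by (cases a; cases b) auto

text \<open>Every node of the pair other than the root is a node of \<open>g\<close> or of
  \<open>h\<close>, so only the root adds conditions: the two sign equations.\<close>

lemma pair_aut_in_B_group_iff:
  assumes "g \<in> tree_aut" "h \<in> tree_aut"
  shows "pair_aut g h \<in> B_group r s \<longleftrightarrow> g \<in> B_group r s \<and> h \<in> B_group r s \<and>
    par_sum (r - 1) g [] = par_sum (s - 1) h [] \<and> par_sum (r - 1) h [] = par_sum (s - 1) g []"
    (is "?L \<longleftrightarrow> ?R")
proof
  assume ?L
  then have *: "P\<^sub>a r s (pair_aut g h) x = 0" "P\<^sub>b r s (pair_aut g h) x = 0" for x
    by (auto simp: B_group_iff)
  show ?R
    using *[of "[]"] *[of "La # _"] *[of "Lb # _"] assms
    by (simp add: B_group_iff P\<^sub>a_pair_aut bit_add_eq_0 del: add_bit_eq_xor)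
next
  assume R: ?R
  have "P\<^sub>a r s (pair_aut g h) x = 0 \<and> P\<^sub>b r s (pair_aut g h) x = 0" for x
    using R by (cases "(g, h, x)" rule: pair_aut.cases)
      (auto simp: B_group_iff P\<^sub>a_pair_aut bit_add_eq_0 simp del: add_bit_eq_xor)
  then show ?L using assms by (simp add: B_group_iff pair_aut_in_tree_aut)
qed

lemma tree_aut_pair_decomp:
  assumes "\<sigma> \<in> tree_aut" "Par \<sigma> [] = 0"
  obtains g h where "g \<in> tree_aut" "h \<in> tree_aut" "\<sigma> = pair_aut g h"
proof -
  define g where "g = aut_with_Par (\<lambda>w. Par \<sigma> (La # w))"
  define h where "h = aut_with_Par (\<lambda>w. Par \<sigma> (Lb # w))"
  have gh: "g \<in> tree_aut" "h \<in> tree_aut"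
    by (auto simp: g_def h_def aut_with_Par_in_tree_aut)
  have "\<sigma> = pair_aut g h"
  proof (rule tree_aut_eqI[OF assms(1) pair_aut_in_tree_aut[OF gh]])
    fix x show "Par \<sigma> x = Par (pair_aut g h) x"
      by (cases "(g, h, x)" rule: pair_aut.cases) (use assms gh in \<open>auto simp: g_def h_def\<close>)
  qed
  with gh that show thesis by blast
qed

section \<open>The profinite topology\<close>

lemma topspace_profinite: "topspace profinite_topology = tree_aut"
  unfolding profinite_topology_def topology_generated_by_topspace
  by (auto simp: level_cylinder_def)

lemma openin_level_cylinder: "\<rho> \<in> tree_aut \<Longrightarrow> openin profinite_topology (level_cylinder n \<rho>)"
  unfolding profinite_topology_def by (rule topology_generated_by_Basis) blast

text \<open>Cylinders around \<open>\<sigma>\<close> are nested, and any cylinder containing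
  \<open>\<sigma>\<close> contains the one of the same level around \<open>\<sigma>\<close>, so they
  form a neighbourhood base.\<close>

lemma level_cylinder_subset_open:
  assumes "openin profinite_topology U" "\<sigma> \<in> U"
  shows "\<exists>n. level_cylinder n \<sigma> \<subseteq> U"
proof -
  have "generate_topology_on {level_cylinder n \<rho> |n \<rho>. \<rho> \<in> tree_aut} U"
    using assms(1) unfolding profinite_topology_def by (simp add: openin_topology_generated_by_iff)
  then show ?thesis using assms(2)
  proof (induction rule: generate_topology_on.induct)
    case (Int a b)
    then obtain m n where "level_cylinder m \<sigma> \<subseteq> a" "level_cylinder n \<sigma> \<subseteq> b" by blast
    moreover have "level_cylinder (max m n) \<sigma> \<subseteq> level_cylinder m \<sigma> \<inter> level_cylinder n \<sigma>"
      by (auto simp: level_cylinder_def)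
    ultimately show ?case by blast
  next
    case (UN K)
    then show ?case by blast
  next
    case (Basis U)
    then obtain n \<rho> where U: "U = level_cylinder n \<rho>" by blast
    have "level_cylinder n \<sigma> \<subseteq> U"
      using Basis.prems unfolding U by (auto simp: level_cylinder_def)
    then show ?case by blast
  qed auto
qed

lemma in_profinite_closure_iff:
  assumes "A \<subseteq> tree_aut"
  shows "\<sigma> \<in> profinite_topology closure_of A \<longleftrightarrow>
    \<sigma> \<in> tree_aut \<and> (\<forall>n. \<exists>g\<in>A. \<forall>x. length x \<le> n \<longrightarrow> g x = \<sigma> x)" (is "?L \<longleftrightarrow> ?R")
proof
  assume L: ?L
  then have \<sigma>: "\<sigma> \<in> tree_aut" by (simp add: in_closure_of topspace_profinite)
  have "\<exists>g\<in>A. \<forall>x. length x \<le> n \<longrightarrow> g x = \<sigma> x" for n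
  proof -
    have "\<sigma> \<in> level_cylinder n \<sigma>" using \<sigma> by (simp add: level_cylinder_def)
    with L openin_level_cylinder[OF \<sigma>, of n]
    obtain g where "g \<in> A" "g \<in> level_cylinder n \<sigma>" by (auto simp: in_closure_of)
    then show ?thesis by (auto simp: level_cylinder_def)
  qed
  with \<sigma> show ?R by blast
next
  assume R: ?R
  have "\<exists>g. g \<in> A \<and> g \<in> T" if T: "\<sigma> \<in> T" "openin profinite_topology T" for T
  proof -
    obtain n where n: "level_cylinder n \<sigma> \<subseteq> T" using level_cylinder_subset_open T by blast
    obtain g where "g \<in> A" "\<forall>x. length x \<le> n \<longrightarrow> g x = \<sigma> x" using R by blast
    with assms n show ?thesis by (auto simp: level_cylinder_def)
  qed
  with R show ?L by (auto simp: in_closure_of topspace_profinite)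
qed

section \<open>The group generated by Pink's automorphisms\<close>

locale pink =
  fixes r s :: nat
  assumes s_less_r: "s < r" and s_ge_2: "2 \<le> s" and r_ge_4: "4 \<le> r"
begin

abbreviation \<alpha> :: "nat \<Rightarrow> word \<Rightarrow> word" where
  "\<alpha> \<equiv> pink_gen r s"

definition G\<^sub>0 :: "(word \<Rightarrow> word) set" where
  "G\<^sub>0 = generate AutT (\<alpha> ` {1..r})"

section \<open>Recursion, order and level signs of the generators\<close>

lemma \<alpha>_in_tree_aut: "\<alpha> i \<in> tree_aut"
  unfolding pink_gen_def by (rule aut_with_Par_in_tree_aut)

lemma \<alpha>_1: "\<alpha> 1 = tau"
  using s_ge_2 by (intro pink_gen_1) simp

lemma \<alpha>_Suc_s: "\<alpha> (Suc s) = pair_aut (\<alpha> s) (\<alpha> r)"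
  using pink_gen_Suc_s[of s r] s_less_r s_ge_2 by (simp add: aut_pair_eq \<alpha>_in_tree_aut)

lemma \<alpha>_Suc: "1 \<le> i \<Longrightarrow> i < r \<Longrightarrow> i \<noteq> s \<Longrightarrow> \<alpha> (Suc i) = pair_aut (\<alpha> i) id"
  using pink_gen_other[of s r "Suc i"] s_less_r s_ge_2
  by (simp add: aut_pair_eq \<alpha>_in_tree_aut id_in_tree_aut)

lemma index_cases [consumes 1, case_names 1 Suc_s Suc]:
  assumes "i \<in> {1..r}"
  obtains "i = 1" | "i = Suc s" | j where "i = Suc j" "1 \<le> j" "j < r" "j \<noteq> s"
  using assms that(1,2) that(3)[of "i - 1"] by (cases "i = 1 \<or> i = Suc s") auto

lemma s_r_index: "s \<in> {1..r}" "r \<in> {1..r}"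
  using s_less_r s_ge_2 by auto

text \<open>The induction is on the word with \<open>i\<close> free: \<open>\<alpha> (Suc s)\<close>
  refers to \<open>\<alpha> r\<close>, so the index need not decrease, but the word always gets
  shorter.\<close>

lemma \<alpha>_involution_apply: "i \<in> {1..r} \<Longrightarrow> \<alpha> i (\<alpha> i w) = w"
proof (induction w arbitrary: i)
  case Nil
  show ?case by (simp add: \<alpha>_in_tree_aut)
next
  case (Cons c w)
  from Cons.prems show ?case
  proof (cases rule: index_cases)
    case 1
    then show ?thesis using fun_cong[OF tau_tau, of "c # w"] by (simp only: \<alpha>_1) simp
  next
    case Suc_s
    then show ?thesis using Cons.IH s_r_index by (cases c) (simp_all add: \<alpha>_Suc_s)
  next
    case (Suc j)
    then show ?thesis using Cons.IH[of j] by (cases c) (simp_all add: \<alpha>_Suc)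
  qed
qed

lemma \<alpha>_involution: "i \<in> {1..r} \<Longrightarrow> \<alpha> i \<circ> \<alpha> i = id"
  by (rule ext) (simp add: \<alpha>_involution_apply)

lemma \<alpha>_cancel: "i \<in> {1..r} \<Longrightarrow> \<alpha> i \<circ> (\<alpha> i \<circ> f) = f"
  by (simp add: comp_assoc[symmetric] \<alpha>_involution)

lemmas s_r_cancel = \<alpha>_involution[OF s_r_index(1)] \<alpha>_involution[OF s_r_index(2)]
  \<alpha>_cancel[OF s_r_index(1)] \<alpha>_cancel[OF s_r_index(2)]

lemma \<alpha>_fixes_short: "i \<in> {1..r} \<Longrightarrow> length w < i \<Longrightarrow> \<alpha> i w = w"
proof (induction w arbitrary: i)
  case Nil
  show ?case by (simp add: \<alpha>_in_tree_aut)
next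
  case (Cons c w)
  from Cons.prems(1) show ?case
  proof (cases rule: index_cases)
    case 1
    with Cons.prems(2) show ?thesis by simp
  next
    case Suc_s
    then show ?thesis using Cons s_r_index s_less_r by (cases c) (simp_all add: \<alpha>_Suc_s)
  next
    case (Suc j)
    then show ?thesis using Cons.IH[of j] Cons.prems by (cases c) (simp_all add: \<alpha>_Suc)
  qed
qed

text \<open>For \<open>i = Suc s\<close> the recursion adds the signs of \<open>\<alpha> s\<close>
  and \<open>\<alpha> r\<close> one level up; the latter is zero because that level is still below
  \<open>r - 1\<close>.\<close>

lemma level_sign_\<alpha>: "i \<in> {1..r} \<Longrightarrow> k < r \<Longrightarrow> par_sum k (\<alpha> i) [] = of_bool (Suc k = i)"
proof (induction k arbitrary: i)
  case 0
  from 0(1) show ?case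
    by (cases rule: index_cases)
       (use s_ge_2 in \<open>simp_all add: \<alpha>_1[simplified] \<alpha>_Suc_s \<alpha>_Suc par_sum_tau_root par_sum_0 Par_tau \<alpha>_in_tree_aut\<close>)
next
  case (Suc k)
  from Suc.prems(1) show ?case
  proof (cases rule: index_cases)
    case 1
    then show ?thesis by (simp add: \<alpha>_1[simplified] par_sum_tau_root)
  next
    case Suc_s
    then show ?thesis
      using Suc.IH[OF s_r_index(1)] Suc.IH[OF s_r_index(2)] Suc.prems
      by (simp add: par_sum_Suc \<alpha>_Suc_s)
  next
    case (Suc j)
    then show ?thesis using Suc.IH[of j] Suc.prems by (simp add: par_sum_Suc \<alpha>_Suc)
  qed
qed

lemma level_sign_\<alpha>_r_s:
  assumes "i \<in> {1..r}"
  shows "par_sum (r - 1) (\<alpha> i) [] = of_bool (i = r)" "par_sum (s - 1) (\<alpha> i) [] = of_bool (i = s)"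
  using level_sign_\<alpha>[OF assms, of "r - 1"] level_sign_\<alpha>[OF assms, of "s - 1"] s_less_r s_ge_2
  by auto

text \<open>At the root, the signs of \<open>\<alpha> s\<close> and \<open>\<alpha> r\<close> on
  levels \<open>r - 1\<close> and \<open>s - 1\<close> are those of each other exchanged, as
  \<open>\<alpha> (Suc s)\<close> requires. In the pairs \<open>(\<alpha> j, id)\<close> these signs
  are all zero, since \<open>j\<close> is neither \<open>s\<close> nor \<open>r\<close>.\<close>

lemma \<alpha>_in_B_group:
  assumes "i \<in> {1..r}"
  shows "\<alpha> i \<in> B_group r s"
proof -
  have "P\<^sub>a r s (\<alpha> i) x = 0 \<and> P\<^sub>b r s (\<alpha> i) x = 0" for x
    using assms
  proof (induction x arbitrary: i)
    case Nil
    then show ?case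
    proof (cases rule: index_cases)
      case 1
      then show ?thesis using tau_in_B_group \<alpha>_1 by (simp add: B_group_iff)
    next
      case Suc_s
      then show ?thesis using s_less_r s_r_index
        by (simp add: \<alpha>_Suc_s P\<^sub>a_pair_aut level_sign_\<alpha>_r_s del: One_nat_def)
    next
      case (Suc j)
      then show ?thesis by (simp add: \<alpha>_Suc P\<^sub>a_pair_aut level_sign_\<alpha>_r_s del: One_nat_def)
    qed
  next
    case (Cons c x)
    from Cons.prems show ?case
    proof (cases rule: index_cases)
      case 1
      then show ?thesis using tau_in_B_group \<alpha>_1 by (simp add: B_group_iff)
    next
      case Suc_s
      then show ?thesis using Cons.IH s_r_index
        by (cases c) (simp_all add: \<alpha>_Suc_s P\<^sub>a_pair_aut)
    next
      case (Suc j)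
      then show ?thesis using Cons.IH[of j] id_in_B_group[of r s]
        by (cases c) (simp_all add: \<alpha>_Suc P\<^sub>a_pair_aut B_group_iff)
    qed
  qed
  then show ?thesis by (simp add: B_group_iff \<alpha>_in_tree_aut)
qed

section \<open>The abstract subgroup \<open>G\<^sub>0\<close> and its first pairs\<close>

lemma id_in_G\<^sub>0: "id \<in> G\<^sub>0"
  unfolding G\<^sub>0_def using generate.one[of AutT] by (simp add: AutT_def)

lemma \<alpha>_in_G\<^sub>0: "i \<in> {1..r} \<Longrightarrow> \<alpha> i \<in> G\<^sub>0"
  unfolding G\<^sub>0_def by (rule generate.incl) simp

lemma comp_in_G\<^sub>0: "g \<in> G\<^sub>0 \<Longrightarrow> h \<in> G\<^sub>0 \<Longrightarrow> g \<circ> h \<in> G\<^sub>0"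
  unfolding G\<^sub>0_def using generate.eng[of g AutT _ h] by (simp add: AutT_def)

lemma inv_\<alpha>:
  assumes "i \<in> {1..r}"
  shows "inv\<^bsub>AutT\<^esub> (\<alpha> i) = \<alpha> i"
  using assms
  by (intro group.inv_equality[OF group_AutT]) (simp_all add: AutT_def \<alpha>_involution \<alpha>_in_tree_aut)

text \<open>The generators are involutions, so products of generators exhaust \<open>G\<^sub>0\<close>.\<close>

lemma G\<^sub>0_induct [consumes 1, case_names id step]:
  assumes "g \<in> G\<^sub>0" and "P id"
    and step: "\<And>i h. i \<in> {1..r} \<Longrightarrow> h \<in> G\<^sub>0 \<Longrightarrow> P h \<Longrightarrow> P (\<alpha> i \<circ> h)"
  shows "P g"
proof -
  \<comment> \<open>Left multiplication onto an arbitrary \<open>h\<close> is the form that survives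
    the product case of \<open>generate\<close>, where both factors are arbitrary.\<close>
  have "h \<in> G\<^sub>0 \<and> P h \<longrightarrow> g \<circ> h \<in> G\<^sub>0 \<and> P (g \<circ> h)" for h
    using assms(1) unfolding G\<^sub>0_def
  proof (induction arbitrary: h rule: generate.induct)
    case one
    then show ?case by (simp add: AutT_def)
  next
    case (incl g)
    then show ?case using step comp_in_G\<^sub>0[OF \<alpha>_in_G\<^sub>0] unfolding G\<^sub>0_def by blast
  next
    case (inv g)
    then obtain i where "i \<in> {1..r}" "g = \<alpha> i" by blast
    then have "inv\<^bsub>AutT\<^esub> g = \<alpha> i" by (simp only: inv_\<alpha>)
    with \<open>i \<in> {1..r}\<close> show ?case using step comp_in_G\<^sub>0[OF \<alpha>_in_G\<^sub>0] unfolding G\<^sub>0_def by metis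
  next
    case (eng g1 g2)
    then show ?case by (simp add: AutT_def comp_assoc)
  qed
  from this[of id] show ?thesis using assms(2) id_in_G\<^sub>0 by simp
qed

lemma G\<^sub>0_subset_B_group: "g \<in> G\<^sub>0 \<Longrightarrow> g \<in> B_group r s"
  by (induction rule: G\<^sub>0_induct) (blast intro: id_in_B_group comp_in_B_group \<alpha>_in_B_group)+

lemma G\<^sub>0_subset_tree_aut: "g \<in> G\<^sub>0 \<Longrightarrow> g \<in> tree_aut"
  using G\<^sub>0_subset_B_group B_group_tree_aut by blast

lemma tau_in_G\<^sub>0: "tau \<in> G\<^sub>0"
  using \<alpha>_in_G\<^sub>0[of 1] \<alpha>_1 r_ge_4 by simp

lemma pair_swap_G\<^sub>0: "pair_aut g h \<in> G\<^sub>0 \<Longrightarrow> pair_aut h g \<in> G\<^sub>0"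
  using comp_in_G\<^sub>0[OF tau_in_G\<^sub>0 comp_in_G\<^sub>0[OF _ tau_in_G\<^sub>0]] by (metis tau_pair_tau)

lemma pair_comp_G\<^sub>0:
  "pair_aut g h \<in> G\<^sub>0 \<Longrightarrow> pair_aut g' h' \<in> G\<^sub>0 \<Longrightarrow> pair_aut (g \<circ> g') (h \<circ> h') \<in> G\<^sub>0"
  using comp_in_G\<^sub>0 by (metis pair_aut_comp)

lemma pair_s_r_G\<^sub>0: "pair_aut (\<alpha> s) (\<alpha> r) \<in> G\<^sub>0" and pair_r_s_G\<^sub>0: "pair_aut (\<alpha> r) (\<alpha> s) \<in> G\<^sub>0"
  using \<alpha>_in_G\<^sub>0[of "Suc s"] s_less_r pair_swap_G\<^sub>0 by (auto simp: \<alpha>_Suc_s)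

lemma pair_\<alpha>_id_G\<^sub>0: "i \<in> {1..r} \<Longrightarrow> i \<noteq> s \<Longrightarrow> i \<noteq> r \<Longrightarrow> pair_aut (\<alpha> i) id \<in> G\<^sub>0"
  using \<alpha>_in_G\<^sub>0[of "Suc i"] by (simp add: \<alpha>_Suc)

section \<open>Commutators in one coordinate, and which pairs lie in
  \<open>G\<^sub>0\<close>\<close>

lemma ex_conj_commute:
  "\<exists>i\<in>{1..r}. i \<noteq> s \<and> i \<noteq> r \<and> (\<alpha> i \<circ> \<alpha> s \<circ> \<alpha> i) \<circ> \<alpha> r = \<alpha> r \<circ> (\<alpha> i \<circ> \<alpha> s \<circ> \<alpha> i)"
proof -
  obtain t where t: "s = Suc t" "1 \<le> t" using s_ge_2 by (cases s) auto
  have s: "\<alpha> s = pair_aut (\<alpha> t) id" using \<alpha>_Suc[of t] t s_less_r by simp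
  show ?thesis
  proof (cases "r = Suc s")
    case False
    then obtain q where "r = Suc q" "1 \<le> q" "q \<noteq> s" using r_ge_4 by (cases r) auto
    then have r: "\<alpha> r = pair_aut (\<alpha> q) id" using \<alpha>_Suc[of q] by simp
    \<comment> \<open>Conjugation by \<open>tau\<close> moves \<open>\<alpha> s\<close> into the
      right coordinate, while \<open>\<alpha> r\<close> acts only in the left one.\<close>
    have "\<alpha> 1 \<circ> \<alpha> s \<circ> \<alpha> 1 = pair_aut id (\<alpha> t)"
      by (simp only: \<alpha>_1 s comp_assoc tau_pair_tau)
    then show ?thesis using r_ge_4 s_ge_2
      by (intro bexI[of _ 1]) (simp_all add: r pair_aut_comp)
  next
    case True
    \<comment> \<open>Now \<open>\<alpha> r\<close> is \<open>(\<alpha> s, \<alpha> r)\<close>, so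
      the supports are separated one level deeper, inside the left coordinate. Here
      \<open>s \<ge> 3\<close>, which supplies \<open>u = s - 2\<close>.\<close>
    then obtain u where u: "t = Suc u" "1 \<le> u" using t r_ge_4 by (cases t) auto
    have t': "\<alpha> t = pair_aut (\<alpha> u) id" using \<alpha>_Suc[of u] t u s_less_r by simp
    have 2: "\<alpha> 2 = pair_aut tau id"
      using \<alpha>_Suc[of 1] \<alpha>_1 s_ge_2 r_ge_4 t u by (simp add: numeral_2_eq_2)
    have r: "\<alpha> r = pair_aut (\<alpha> s) (\<alpha> r)" using \<alpha>_Suc_s True by simp
    have "\<alpha> 2 \<circ> \<alpha> s \<circ> \<alpha> 2 = pair_aut (pair_aut id (\<alpha> u)) id"
      by (simp add: 2 s t' pair_aut_comp comp_assoc tau_pair_tau)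
    moreover have "pair_aut (pair_aut id (\<alpha> u)) id \<circ> \<alpha> r = \<alpha> r \<circ> pair_aut (pair_aut id (\<alpha> u)) id"
      by (subst (1 2) r) (simp add: s pair_aut_comp)
    ultimately show ?thesis using r_ge_4 t u True by (intro bexI[of _ 2]) auto
  qed
qed

text \<open>All factors are involutions, so these are commutators. That of
  \<open>(c, \<alpha> r)\<close> and \<open>(\<alpha> r, \<alpha> s)\<close> is trivial on the left,
  where \<open>c\<close> is the conjugate of \<open>\<alpha> s\<close> commuting with
  \<open>\<alpha> r\<close>.\<close>

lemma pair_id_commutator_G\<^sub>0:
  "pair_aut id (\<alpha> r \<circ> \<alpha> s \<circ> \<alpha> r \<circ> \<alpha> s) \<in> G\<^sub>0" "pair_aut id (\<alpha> s \<circ> \<alpha> r \<circ> \<alpha> s \<circ> \<alpha> r) \<in> G\<^sub>0"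
proof -
  obtain i where i: "i \<in> {1..r}" "i \<noteq> s" "i \<noteq> r"
    and comm: "(\<alpha> i \<circ> \<alpha> s \<circ> \<alpha> i) \<circ> \<alpha> r = \<alpha> r \<circ> (\<alpha> i \<circ> \<alpha> s \<circ> \<alpha> i)"
    using ex_conj_commute by blast
  define c where "c = \<alpha> i \<circ> \<alpha> s \<circ> \<alpha> i"
  have "c \<circ> c = id"
    using i s_r_index by (simp add: c_def comp_assoc \<alpha>_cancel \<alpha>_involution)
  then have c: "c \<circ> \<alpha> r = \<alpha> r \<circ> c" "c \<circ> (c \<circ> f) = f" for f
    using comm by (simp_all add: c_def[symmetric] comp_assoc[symmetric])
  then have "c \<circ> (\<alpha> r \<circ> (c \<circ> \<alpha> r)) = id" "\<alpha> r \<circ> (c \<circ> (\<alpha> r \<circ> c)) = id"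
    using \<alpha>_involution[OF s_r_index(2)] \<open>c \<circ> c = id\<close> by (metis comp_assoc comp_id)+
  moreover have c_r: "pair_aut c (\<alpha> r) \<in> G\<^sub>0"
    using pair_comp_G\<^sub>0[OF pair_comp_G\<^sub>0[OF pair_\<alpha>_id_G\<^sub>0[OF i] pair_s_r_G\<^sub>0] pair_\<alpha>_id_G\<^sub>0[OF i]]
    by (simp add: c_def)
  ultimately show "pair_aut id (\<alpha> r \<circ> \<alpha> s \<circ> \<alpha> r \<circ> \<alpha> s) \<in> G\<^sub>0"
    "pair_aut id (\<alpha> s \<circ> \<alpha> r \<circ> \<alpha> s \<circ> \<alpha> r) \<in> G\<^sub>0"
    using pair_comp_G\<^sub>0[OF c_r pair_comp_G\<^sub>0[OF pair_r_s_G\<^sub>0 pair_comp_G\<^sub>0[OF c_r pair_r_s_G\<^sub>0]]]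
      pair_comp_G\<^sub>0[OF pair_r_s_G\<^sub>0 pair_comp_G\<^sub>0[OF c_r pair_comp_G\<^sub>0[OF pair_r_s_G\<^sub>0 c_r]]]
    by (simp_all only: comp_assoc)
qed

text \<open>The four elements represent the group generated by \<open>\<alpha> r\<close> and
  \<open>\<alpha> s\<close> modulo commutators. Multiplying \<open>g\<close> by
  \<open>\<alpha> i\<close> multiplies its partner by \<open>\<alpha> r\<close>,
  \<open>\<alpha> s\<close> or \<open>id\<close>, according as \<open>i = s\<close>,
  \<open>i = r\<close> or neither.\<close>

lemma ex_pair_G\<^sub>0:
  assumes "g \<in> G\<^sub>0"
  shows "\<exists>h\<in>{id, \<alpha> r, \<alpha> s, \<alpha> r \<circ> \<alpha> s}. pair_aut g h \<in> G\<^sub>0"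
  using assms
proof (induction rule: G\<^sub>0_induct)
  case id
  have "pair_aut id id \<in> G\<^sub>0" unfolding pair_aut_id by (rule id_in_G\<^sub>0)
  then show ?case by blast
next
  case (step i g)
  then obtain h where h: "h \<in> {id, \<alpha> r, \<alpha> s, \<alpha> r \<circ> \<alpha> s}" and gh: "pair_aut g h \<in> G\<^sub>0" by blast
  note simps = comp_assoc s_r_cancel
  consider "i = s" | "i = r" | "i \<noteq> s" "i \<noteq> r" by blast
  then show ?case
  proof cases
    case 1
    have "pair_aut (\<alpha> i \<circ> g) (\<alpha> r \<circ> h) \<in> G\<^sub>0"
      using pair_comp_G\<^sub>0[OF pair_s_r_G\<^sub>0 gh] 1 by simp
    moreover have "\<alpha> r \<circ> h \<in> {id, \<alpha> r, \<alpha> s, \<alpha> r \<circ> \<alpha> s}"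
      using h by (elim insertE emptyE) (simp_all add: simps)
    ultimately show ?thesis by blast
  next
    case 2
    have *: "pair_aut (\<alpha> i \<circ> g) (\<alpha> s \<circ> h) \<in> G\<^sub>0"
      using pair_comp_G\<^sub>0[OF pair_r_s_G\<^sub>0 gh] 2 by simp
    \<comment> \<open>If \<open>h\<close> begins with \<open>\<alpha> r\<close>, then
      \<open>\<alpha> s \<circ> h\<close> leaves the list; the commutator exchanges its two leading
      factors and brings it back.\<close>
    have **: "pair_aut (\<alpha> i \<circ> g) (\<alpha> r \<circ> \<alpha> s \<circ> \<alpha> r \<circ> \<alpha> s \<circ> (\<alpha> s \<circ> h)) \<in> G\<^sub>0"
      using pair_comp_G\<^sub>0[OF pair_id_commutator_G\<^sub>0(1) *] by simp
    from h consider "h \<in> {id, \<alpha> s}" | "h \<in> {\<alpha> r, \<alpha> r \<circ> \<alpha> s}" by blast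
    then show ?thesis
    proof cases
      case 1
      then have "\<alpha> s \<circ> h \<in> {id, \<alpha> r, \<alpha> s, \<alpha> r \<circ> \<alpha> s}"
        by (elim insertE emptyE) (simp_all add: simps)
      with * show ?thesis by blast
    next
      case 2
      then have "\<alpha> r \<circ> \<alpha> s \<circ> \<alpha> r \<circ> \<alpha> s \<circ> (\<alpha> s \<circ> h) \<in> {id, \<alpha> r, \<alpha> s, \<alpha> r \<circ> \<alpha> s}"
        by (elim insertE emptyE) (simp_all add: simps)
      with ** show ?thesis by blast
    qed
  next
    case 3
    have "pair_aut (\<alpha> i \<circ> g) h \<in> G\<^sub>0"
      using pair_comp_G\<^sub>0[OF pair_\<alpha>_id_G\<^sub>0[OF step(1) 3] gh] by simp
    with h show ?thesis by blast
  qed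
qed

text \<open>For partners \<open>g'\<close>, \<open>h'\<close> of \<open>g\<close>, \<open>h\<close>,
  the pair \<open>(g, h)\<close> is the product of \<open>(g, g')\<close>, \<open>(x, y)\<close> and
  \<open>(h', h)\<close>, with \<open>x\<close> inverse to \<open>h'\<close> and \<open>y\<close>
  inverse to \<open>g'\<close>. The two signs tell the four partners apart, and those of
  \<open>h'\<close> are those of \<open>g'\<close> exchanged, which leaves four
  combinations.\<close>

lemma pair_in_G\<^sub>0:
  assumes g: "g \<in> G\<^sub>0" and h: "h \<in> G\<^sub>0"
    and "par_sum (r - 1) g [] = par_sum (s - 1) h []" "par_sum (r - 1) h [] = par_sum (s - 1) g []"
  shows "pair_aut g h \<in> G\<^sub>0"
proof -
  let ?V = "{id, \<alpha> r, \<alpha> s, \<alpha> r \<circ> \<alpha> s}"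
  note simps = comp_assoc s_r_cancel
  have signs:
    "par_sum (r - 1) id [] = 0" "par_sum (r - 1) (\<alpha> r) [] = 1" "par_sum (r - 1) (\<alpha> s) [] = 0"
    "par_sum (r - 1) (\<alpha> r \<circ> \<alpha> s) [] = 1"
    "par_sum (s - 1) id [] = 0" "par_sum (s - 1) (\<alpha> r) [] = 0" "par_sum (s - 1) (\<alpha> s) [] = 1"
    "par_sum (s - 1) (\<alpha> r \<circ> \<alpha> s) [] = 1"
    using s_less_r s_r_index
    by (simp_all add: level_sign_\<alpha>_r_s par_sum_comp \<alpha>_in_tree_aut del: One_nat_def)
  have compl: "par_sum (r - 1) v [] = par_sum (s - 1) u []" "par_sum (s - 1) v [] = par_sum (r - 1) u []"
    if "u \<in> G\<^sub>0" "pair_aut u v \<in> G\<^sub>0" "v \<in> ?V" for u v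
  proof -
    have "v \<in> tree_aut"
      using that(3) \<alpha>_in_tree_aut id_in_tree_aut comp_in_tree_aut by auto
    then show "par_sum (r - 1) v [] = par_sum (s - 1) u []" "par_sum (s - 1) v [] = par_sum (r - 1) u []"
      using G\<^sub>0_subset_B_group[OF that(2)] G\<^sub>0_subset_tree_aut[OF that(1)]
      by (simp_all add: pair_aut_in_B_group_iff)
  qed
  obtain g' where g': "g' \<in> ?V" "pair_aut g g' \<in> G\<^sub>0" using ex_pair_G\<^sub>0[OF g] by blast
  obtain h' where h': "h' \<in> ?V" "pair_aut h h' \<in> G\<^sub>0" using ex_pair_G\<^sub>0[OF h] by blast
  have *: "par_sum (r - 1) g' [] = par_sum (s - 1) h' []" "par_sum (s - 1) g' [] = par_sum (r - 1) h' []"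
    using compl[OF g g'(2,1)] compl[OF h h'(2,1)] assms(3,4) by auto
  have h'h: "pair_aut h' h \<in> G\<^sub>0" using pair_swap_G\<^sub>0[OF h'(2)] .
  have via: "pair_aut (g \<circ> (x \<circ> h')) (g' \<circ> (y \<circ> h)) \<in> G\<^sub>0" if "pair_aut x y \<in> G\<^sub>0" for x y
    using pair_comp_G\<^sub>0[OF g'(2) pair_comp_G\<^sub>0[OF that h'h]] .
  \<comment> \<open>This is the inverse of \<open>\<alpha> r \<circ> \<alpha> s\<close> in both
    coordinates, for the last combination; the commutator corrects the order on the right.\<close>
  have "pair_aut (\<alpha> s \<circ> \<alpha> r) (\<alpha> s \<circ> \<alpha> r) \<in> G\<^sub>0"
    using pair_comp_G\<^sub>0[OF pair_comp_G\<^sub>0[OF pair_s_r_G\<^sub>0 pair_r_s_G\<^sub>0] pair_id_commutator_G\<^sub>0(2)]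
    by (simp add: simps)
  note vias = via[OF this] via[OF pair_s_r_G\<^sub>0] via[OF pair_r_s_G\<^sub>0] via[of id id]
  consider "g' = id" "h' = id" | "g' = \<alpha> r" "h' = \<alpha> s" | "g' = \<alpha> s" "h' = \<alpha> r"
    | "g' = \<alpha> r \<circ> \<alpha> s" "h' = \<alpha> r \<circ> \<alpha> s"
    using g'(1) h'(1) *
    by (elim insertE emptyE; hypsubst) (simp_all add: signs del: One_nat_def par_sum_id)
  then show ?thesis
    by cases (use vias id_in_G\<^sub>0 in \<open>simp_all add: simps pair_aut_id\<close>)
qed

section \<open>Approximation of B by \<open>G\<^sub>0\<close>, and passage to the closure\<close>

lemma ex_G\<^sub>0_level_eq:
  assumes "\<sigma> \<in> B_group r s"
  shows "\<exists>g\<in>G\<^sub>0. \<forall>x. length x \<le> n \<longrightarrow> g x = \<sigma> x"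
  using assms
proof (induction n arbitrary: \<sigma>)
  case 0
  have "\<sigma> [] = []" using B_group_tree_aut[OF 0] by simp
  then show ?case using id_in_G\<^sub>0 by (intro bexI[of _ id]) auto
next
  case (Suc n)
  have even: "\<exists>g\<in>G\<^sub>0. \<forall>x. length x \<le> Suc n \<longrightarrow> g x = \<rho> x"
    if \<rho>: "\<rho> \<in> B_group r s" "Par \<rho> [] = 0" for \<rho>
  proof -
    obtain a b where ab: "a \<in> tree_aut" "b \<in> tree_aut" "\<rho> = pair_aut a b"
      using tree_aut_pair_decomp B_group_tree_aut \<rho> by metis
    with \<rho> have B: "a \<in> B_group r s" "b \<in> B_group r s"
      and sgn: "par_sum (r - 1) a [] = par_sum (s - 1) b []" "par_sum (r - 1) b [] = par_sum (s - 1) a []"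
      by (auto simp: pair_aut_in_B_group_iff)
    obtain g where g: "g \<in> G\<^sub>0" "\<And>x. length x \<le> n \<Longrightarrow> g x = a x" using Suc.IH[OF B(1)] by blast
    obtain h where h: "h \<in> G\<^sub>0" "\<And>x. length x \<le> n \<Longrightarrow> h x = b x" using Suc.IH[OF B(2)] by blast
    \<comment> \<open>Right multiplication by \<open>\<alpha> r\<close> is invisible on words of
      length at most \<open>n < r\<close>, flips the sign on level \<open>r - 1\<close> and keeps
      that on level \<open>s - 1\<close>.\<close>
    have adjust: "\<exists>f'\<in>G\<^sub>0. (\<forall>x. length x \<le> n \<longrightarrow> f' x = f x) \<and> par_sum (r - 1) f' [] = e
        \<and> par_sum (s - 1) f' [] = par_sum (s - 1) f []" if "n < r" "f \<in> G\<^sub>0" for f e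
    proof (cases "par_sum (r - 1) f [] = e")
      case True
      then show ?thesis using that by blast
    next
      case False
      then have "par_sum (r - 1) f [] + 1 = e" by (cases "par_sum (r - 1) f []"; cases e) auto
      then show ?thesis
        using that s_less_r s_r_index \<alpha>_in_tree_aut G\<^sub>0_subset_tree_aut
        by (intro bexI[of _ "f \<circ> \<alpha> r"])
           (auto simp: comp_in_G\<^sub>0 \<alpha>_in_G\<^sub>0 \<alpha>_fixes_short level_sign_\<alpha>_r_s par_sum_comp simp del: One_nat_def)
    qed
    have "\<exists>g'\<in>G\<^sub>0. \<exists>h'\<in>G\<^sub>0. (\<forall>x. length x \<le> n \<longrightarrow> g' x = a x \<and> h' x = b x) \<and>
      par_sum (r - 1) g' [] = par_sum (s - 1) h' [] \<and> par_sum (r - 1) h' [] = par_sum (s - 1) g' []"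
    proof (cases "n < r")
      case True
      \<comment> \<open>Both targets are signs on level \<open>s - 1\<close>, which the corrections
        leave alone, so the two conditions are met independently.\<close>
      from adjust[OF this g(1), of "par_sum (s - 1) h []"] adjust[OF this h(1), of "par_sum (s - 1) g []"]
      show ?thesis using g h by (metis (no_types, lifting))
    next
      case False
      \<comment> \<open>Since \<open>n \<ge> r\<close>, agreement up to length \<open>n\<close>
        carries the signs of \<open>a\<close> and \<open>b\<close> on all levels below
        \<open>r\<close> over to \<open>g\<close> and \<open>h\<close>.\<close>
      have "par_sum k g [] = par_sum k a []" "par_sum k h [] = par_sum k b []" if "k < r" for k
        using par_sum_cong_level[of n g a "[]" k] par_sum_cong_level[of n h b "[]" k] g h that False
        by auto
      then show ?thesis using g h sgn s_less_r
        by (intro bexI[of _ g] bexI[of _ h]) auto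
    qed
    then obtain g' h' where gh: "\<And>x. length x \<le> n \<Longrightarrow> g' x = a x \<and> h' x = b x" "pair_aut g' h' \<in> G\<^sub>0"
      using pair_in_G\<^sub>0 by blast
    have "pair_aut g' h' x = \<rho> x" if "length x \<le> Suc n" for x
      using that gh(1) by (cases "(a, b, x)" rule: pair_aut.cases) (auto simp: ab(3))
    with gh(2) show ?thesis by blast
  qed
  show ?case
  proof (cases "Par \<sigma> [] = 0")
    case True
    with even Suc.prems show ?thesis by blast
  next
    case False
    have \<sigma>: "\<sigma> \<in> tree_aut" using Suc.prems by (rule B_group_tree_aut)
    \<comment> \<open>Composing with \<open>tau\<close> clears the root parity; a second composition
      with the involution \<open>tau\<close> undoes this at the end.\<close>
    have "Par (tau \<circ> \<sigma>) [] = 0"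
      using False \<sigma>
      by (simp add: Par_comp[OF tau_in_tree_aut \<sigma>] Par_tau del: o_apply)
    from even[OF comp_in_B_group[OF tau_in_B_group Suc.prems] this]
    obtain g where "g \<in> G\<^sub>0" "\<And>x. length x \<le> Suc n \<Longrightarrow> g x = (tau \<circ> \<sigma>) x" by blast
    then show ?thesis
      using fun_cong[OF tau_tau] comp_in_G\<^sub>0[OF tau_in_G\<^sub>0]
      by (intro bexI[of _ "tau \<circ> g"]) auto
  qed
qed

lemma G_pink_eq_B_group: "G_pink r s = B_group r s"
proof (intro Set.set_eqI iffI)
  have G: "\<sigma> \<in> G_pink r s \<longleftrightarrow>
      \<sigma> \<in> tree_aut \<and> (\<forall>n. \<exists>g\<in>G\<^sub>0. \<forall>x. length x \<le> n \<longrightarrow> g x = \<sigma> x)" for \<sigma>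
    unfolding G_pink_def G\<^sub>0_def[symmetric]
    by (rule in_profinite_closure_iff) (auto simp: G\<^sub>0_subset_tree_aut)
  {
    fix \<sigma> assume "\<sigma> \<in> B_group r s"
    then show "\<sigma> \<in> G_pink r s" using ex_G\<^sub>0_level_eq B_group_tree_aut by (auto simp: G)
  next
    fix \<sigma> assume \<sigma>: "\<sigma> \<in> G_pink r s"
    have "P\<^sub>a r s \<sigma> x = 0 \<and> P\<^sub>b r s \<sigma> x = 0" for x
    proof -
      \<comment> \<open>The sums at \<open>x\<close> read only words of length at most
        \<open>length x + r + 1\<close>, so an approximation up to length \<open>n\<close>
        determines them; this is why B is closed.\<close>
      define n where "n = length x + r + 2"
      obtain g where g: "g \<in> G\<^sub>0" "\<And>x. length x \<le> n \<Longrightarrow> g x = \<sigma> x" using \<sigma> by (auto simp: G)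
      have "par_sum k \<sigma> (x @ [c]) = par_sum k g (x @ [c])" if "k < r" for k c
        using par_sum_cong_level[of n g \<sigma> "x @ [c]" k] g(2) that by (simp add: n_def)
      then have "P\<^sub>a r s \<sigma> x = P\<^sub>a r s g x" "P\<^sub>b r s \<sigma> x = P\<^sub>b r s g x"
        using s_less_r by (simp_all add: P\<^sub>a_par_sum P\<^sub>b_par_sum)
      then show ?thesis using G\<^sub>0_subset_B_group[OF g(1)] by (simp add: B_group_iff)
    qed
    with \<sigma> show "\<sigma> \<in> B_group r s" by (auto simp: G B_group_iff)
  }
qed

end

theorem theorem6p3:
  fixes r s :: nat
  assumes "r > s" and "s \<ge> 2" and "r \<ge> 4"
  shows "G_pink r s = B_group r s"
proof -
  interpret pink r s using assms by unfold_locales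
  show ?thesis by (rule G_pink_eq_B_group)
qed

end
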